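(* If $p:X\to B$ and $p':X\to B'$ are basings of a graph $X$, then $B$ and $B'$ are isomorphic graphs. More precisely, there exists an isomorphism of graphs $h:B'\to B$ such that $h\circ p'$ and $p$ agree on nodes.
   Context: A graph is $X=(X_0,X_1,s,t)$ with a set $X_0$ of nodes, a set $X_1$ of arcs, and functions $s,t:X_1\to X_0$ (source and target); loops, multiple arcs and infinite graphs are allowed. Graph morphisms are pairs of functions on nodes and arcs commuting with $s$ and $t$. $X( *,x)$ denotes the set of arcs of $X$ with target the node $x$. A graph morphism $f:X\to Y$ is a covering when $f:X( *,x)\to Y( *,f(x))$ is a bijection for every node $x$ of $X$; it is an epic covering when it is moreover surjective on nodes (and thus on arcs). A graph $B$ is basal when the only epic coverings $B\to B'$ are isomorphisms. A basing for $X$ is an epic covering $p:X\to B$ where $B$ is basal. *)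

theory Defs
  imports "Graph_Theory.Digraph" "HOL-Library.FuncSet"
begin

text \<open>
  A graph is a possibly infinite \<^locale>\<open>wf_digraph\<close> with loops and multiple arcs allowed;
  \<^const>\<open>tail\<close> is the source map and \<^const>\<open>head\<close> the target map, so \<^const>\<open>in_arcs\<close> \<open>X x\<close> is
  \<open>X(*,x)\<close>.  Maps are total HOL functions of which only the values on nodes and arcs matter.
  The library's \<open>digraph_iso\<close> is not used: it is an equality of records, hence depends on the
  junk values of \<^const>\<open>tail\<close> and \<^const>\<open>head\<close> outside the set of arcs.
\<close>

type_synonym ('a, 'b, 'c, 'd) graph_map = "('a \<Rightarrow> 'c) \<times> ('b \<Rightarrow> 'd)"

definition graph_morphism ::
    "('a, 'b) pre_digraph \<Rightarrow> ('c, 'd) pre_digraph \<Rightarrow> ('a, 'b, 'c, 'd) graph_map \<Rightarrow> bool" where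
  "graph_morphism X Y f \<longleftrightarrow>
     wf_digraph X \<and> wf_digraph Y \<and>
     fst f \<in> verts X \<rightarrow> verts Y \<and>
     snd f \<in> arcs X \<rightarrow> arcs Y \<and>
     (\<forall>e \<in> arcs X. tail Y (snd f e) = fst f (tail X e) \<and> head Y (snd f e) = fst f (head X e))"

definition graph_isomorphism ::
    "('a, 'b) pre_digraph \<Rightarrow> ('c, 'd) pre_digraph \<Rightarrow> ('a, 'b, 'c, 'd) graph_map \<Rightarrow> bool" where
  "graph_isomorphism X Y f \<longleftrightarrow>
     graph_morphism X Y f \<and>
     bij_betw (fst f) (verts X) (verts Y) \<and> bij_betw (snd f) (arcs X) (arcs Y)"

definition isomorphic_graphs :: "('a, 'b) pre_digraph \<Rightarrow> ('c, 'd) pre_digraph \<Rightarrow> bool" where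
  "isomorphic_graphs X Y \<longleftrightarrow> (\<exists>f. graph_isomorphism X Y f)"

definition covering ::
    "('a, 'b) pre_digraph \<Rightarrow> ('c, 'd) pre_digraph \<Rightarrow> ('a, 'b, 'c, 'd) graph_map \<Rightarrow> bool" where
  "covering X Y f \<longleftrightarrow>
     graph_morphism X Y f \<and>
     (\<forall>x \<in> verts X. bij_betw (snd f) (in_arcs X x) (in_arcs Y (fst f x)))"

definition epic_covering ::
    "('a, 'b) pre_digraph \<Rightarrow> ('c, 'd) pre_digraph \<Rightarrow> ('a, 'b, 'c, 'd) graph_map \<Rightarrow> bool" where
  "epic_covering X Y f \<longleftrightarrow> covering X Y f \<and> fst f ` verts X = verts Y"

text \<open>
  HOL cannot quantify over the type of \<open>B'\<close> here.  Taking it to be the type of \<open>B\<close> loses nothing,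
  since an epic covering is surjective on nodes and on arcs; see \<open>basal_any_type\<close> below.
\<close>

definition basal :: "('a, 'b) pre_digraph \<Rightarrow> bool" where
  "basal B \<longleftrightarrow>
     wf_digraph B \<and>
     (\<forall>(B' :: ('a, 'b) pre_digraph) f. epic_covering B B' f \<longrightarrow> graph_isomorphism B B' f)"

definition basing ::
    "('a, 'b) pre_digraph \<Rightarrow> ('c, 'd) pre_digraph \<Rightarrow> ('a, 'b, 'c, 'd) graph_map \<Rightarrow> bool" where
  "basing X B p \<longleftrightarrow> epic_covering X B p \<and> basal B"

lemma graph_isomorphism_iff_inverse:
  "graph_isomorphism X Y f \<longleftrightarrow>
     graph_morphism X Y f \<and>
     (\<exists>g. graph_morphism Y X g \<and>
        (\<forall>x \<in> verts X. fst g (fst f x) = x) \<and> (\<forall>e \<in> arcs X. snd g (snd f e) = e) \<and>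
        (\<forall>y \<in> verts Y. fst f (fst g y) = y) \<and> (\<forall>e \<in> arcs Y. snd f (snd g e) = e))"
  (is "?L \<longleftrightarrow> ?R")
proof
  assume L: ?L
  then have m: "graph_morphism X Y f"
    and v: "bij_betw (fst f) (verts X) (verts Y)" and a: "bij_betw (snd f) (arcs X) (arcs Y)"
    by (auto simp: graph_isomorphism_def)
  define g where "g = (inv_into (verts X) (fst f), inv_into (arcs X) (snd f))"
  have gv: "fst g (fst f x) = x" if "x \<in> verts X" for x
    using that v by (simp add: g_def bij_betw_inv_into_left)
  have ga: "snd g (snd f x) = x" if "x \<in> arcs X" for x
    using that a by (simp add: g_def bij_betw_inv_into_left)
  have fv: "fst f (fst g x) = x" if "x \<in> verts Y" for x
    using that v by (simp add: g_def bij_betw_inv_into_right)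
  have fa: "snd f (snd g x) = x" if "x \<in> arcs Y" for x
    using that a by (simp add: g_def bij_betw_inv_into_right)
  have vX: "fst g y \<in> verts X" if "y \<in> verts Y" for y
    using that v by (simp add: g_def bij_betw_def inv_into_into)
  have aX: "snd g y \<in> arcs X" if "y \<in> arcs Y" for y
    using that a by (simp add: g_def bij_betw_def inv_into_into)
  have "tail X (snd g e) = fst g (tail Y e) \<and> head X (snd g e) = fst g (head Y e)"
    if e: "e \<in> arcs Y" for e
  proof -
    from m aX[OF e] have "tail Y (snd f (snd g e)) = fst f (tail X (snd g e))"
      "head Y (snd f (snd g e)) = fst f (head X (snd g e))"
      "tail X (snd g e) \<in> verts X" "head X (snd g e) \<in> verts X"
      by (auto simp: graph_morphism_def wf_digraph_def)
    then show ?thesis using fa[OF e] gv by auto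
  qed
  with m vX aX have "graph_morphism Y X g" by (auto simp: graph_morphism_def)
  with m gv ga fv fa show ?R by blast
next
  assume ?R
  then obtain g where m: "graph_morphism X Y f" and n: "graph_morphism Y X g" and
    i: "\<forall>x \<in> verts X. fst g (fst f x) = x" "\<forall>e \<in> arcs X. snd g (snd f e) = e"
      "\<forall>y \<in> verts Y. fst f (fst g y) = y" "\<forall>e \<in> arcs Y. snd f (snd g e) = e"
    by blast
  have "bij_betw (fst f) (verts X) (verts Y)"
    by (rule bij_betw_byWitness[where f' = "fst g"])
       (use m n i in \<open>auto simp: graph_morphism_def\<close>)
  moreover have "bij_betw (snd f) (arcs X) (arcs Y)"
    by (rule bij_betw_byWitness[where f' = "snd g"])
       (use m n i in \<open>auto simp: graph_morphism_def\<close>)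
  ultimately show ?L using m by (simp add: graph_isomorphism_def)
qed

lemma epic_covering_surj_arcs:
  assumes "epic_covering X Y f"
  shows "snd f ` arcs X = arcs Y"
proof
  show "snd f ` arcs X \<subseteq> arcs Y"
    using assms by (auto simp: epic_covering_def covering_def graph_morphism_def)
  show "arcs Y \<subseteq> snd f ` arcs X"
  proof
    fix e assume e: "e \<in> arcs Y"
    with assms have "head Y e \<in> fst f ` verts X"
      by (auto simp: epic_covering_def covering_def graph_morphism_def wf_digraph_def)
    then obtain x where x: "x \<in> verts X" "head Y e = fst f x" by auto
    with assms have "snd f ` in_arcs X x = in_arcs Y (fst f x)"
      by (auto simp: epic_covering_def covering_def bij_betw_def)
    moreover have "e \<in> in_arcs Y (fst f x)" using e x by simp
    ultimately have "e \<in> snd f ` in_arcs X x" by simp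
    then show "e \<in> snd f ` arcs X" by auto
  qed
qed

lemma basal_any_type:
  assumes "basal B" and f: "epic_covering B C f"
  shows "graph_isomorphism B C f"
proof -
  define r where "r = inv_into (verts B) (fst f)"
  define q where "q = inv_into (arcs B) (snd f)"
  have sv: "fst f ` verts B = verts C" and sa: "snd f ` arcs B = arcs C"
    and m: "graph_morphism B C f"
    and bij: "\<And>x. x \<in> verts B \<Longrightarrow> bij_betw (snd f) (in_arcs B x) (in_arcs C (fst f x))"
    using f epic_covering_surj_arcs[OF f] by (auto simp: epic_covering_def covering_def)
  have wC: "tail C e \<in> verts C" "head C e \<in> verts C" if "e \<in> arcs C" for e
    using m that by (auto simp: graph_morphism_def wf_digraph_def)
  have fr: "fst f (r y) = y" "r y \<in> verts B" if "y \<in> verts C" for y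
    using that sv by (auto simp: r_def f_inv_into_f inv_into_into)
  have fq: "snd f (q y) = y" "q y \<in> arcs B" if "y \<in> arcs C" for y
    using that sa by (auto simp: q_def f_inv_into_f inv_into_into)
  have injr: "inj_on r (verts C)" by (metis inj_onI fr(1))
  have injq: "inj_on q (arcs C)" by (metis inj_onI fq(1))
  define C' where "C' = \<lparr>verts = r ` verts C, arcs = q ` arcs C,
    tail = (\<lambda>e. r (tail C (snd f e))), head = (\<lambda>e. r (head C (snd f e)))\<rparr>"
  define g where "g = (r \<circ> fst f, q \<circ> snd f)"
  have wf': "wf_digraph C'"
    using wC by unfold_locales (auto simp: C'_def fq)
  have fB: "fst f x \<in> verts C" if "x \<in> verts B" for x using that sv by auto
  have fA: "snd f x \<in> arcs C" if "x \<in> arcs B" for x using that sa by auto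
  have mg: "graph_morphism B C' g"
    using m wf' fB fA by (auto simp: graph_morphism_def g_def C'_def fq)
  have "bij_betw (snd g) (in_arcs B x) (in_arcs C' (fst g x))" if x: "x \<in> verts B" for x
  proof -
    have "in_arcs C' (fst g x) = q ` in_arcs C (fst f x)"
      using fB[OF x] wC injr by (auto simp: in_arcs_def C'_def g_def fq inj_on_eq_iff)
    moreover have "bij_betw q (in_arcs C (fst f x)) (q ` in_arcs C (fst f x))"
      by (rule inj_on_imp_bij_betw) (rule inj_on_subset[OF injq], auto)
    ultimately show ?thesis using bij_betw_trans[OF bij[OF x]] by (simp add: g_def)
  qed
  moreover have "fst g ` verts B = verts C'"
    by (simp add: g_def C'_def image_image flip: sv)
  ultimately have "epic_covering B C' g"
    using mg by (simp add: epic_covering_def covering_def)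
  then have "graph_isomorphism B C' g"
    using \<open>basal B\<close> unfolding basal_def by blast
  then have "inj_on (r \<circ> fst f) (verts B)" "inj_on (q \<circ> snd f) (arcs B)"
    by (auto simp: graph_isomorphism_def bij_betw_def g_def)
  then have "inj_on (fst f) (verts B)" "inj_on (snd f) (arcs B)"
    by (auto dest: inj_on_imageI2)
  then show ?thesis using m sv sa by (simp add: graph_isomorphism_def bij_betw_def)
qed

end

theory Submission
  imports Defs
begin

text \<open>
  An equivalence on the nodes of a graph is harmless to divide out if equivalent nodes have
  incoming arcs in bijection with equivalent sources; so on a basal graph it is equality.  Apply
  this to \<open>B\<close> and the transitive closure of the relation between \<open>p x\<close> and \<open>p y\<close> whenever
  \<open>p' x = p' y\<close>: it follows that \<open>p\<close> factors on nodes through \<open>p'\<close>.  The node map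
  \<open>B' \<rightarrow> B\<close> so obtained extends to an epic covering, which is an isomorphism as \<open>B'\<close> is basal.
\<close>

text \<open>A bisimulation on incoming arcs that respects multiplicity. No equivalence is demanded,
  so that the relation induced by two coverings can be treated before its closure is taken.\<close>

definition locally_congruent :: "('a, 'b) pre_digraph \<Rightarrow> 'a rel \<Rightarrow> bool" where
  "locally_congruent G r \<longleftrightarrow> (\<forall>(x, y) \<in> r. \<exists>\<phi>. bij_betw \<phi> (in_arcs G x) (in_arcs G y) \<and>
     (\<forall>e \<in> in_arcs G x. (tail G e, tail G (\<phi> e)) \<in> r))"

text \<open>The arc bijections along a chain of \<open>r\<close>-steps compose, and each composition
  prolongs the chain between the tails by one step.\<close>

lemma locally_congruent_trancl:
  assumes "locally_congruent G r"
  shows "locally_congruent G (r\<^sup>+)"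
proof -
  have "\<exists>\<phi>. bij_betw \<phi> (in_arcs G x) (in_arcs G y) \<and>
      (\<forall>e \<in> in_arcs G x. (tail G e, tail G (\<phi> e)) \<in> r\<^sup>+)"
    if "(x, y) \<in> r\<^sup>+" for x y
    using that
  proof induction
    case (base y)
    then show ?case using assms unfolding locally_congruent_def by blast
  next
    case (step y z)
    then obtain \<phi> where \<phi>: "bij_betw \<phi> (in_arcs G x) (in_arcs G y)"
      "\<forall>e \<in> in_arcs G x. (tail G e, tail G (\<phi> e)) \<in> r\<^sup>+" by blast
    from step.hyps assms obtain \<psi> where \<psi>: "bij_betw \<psi> (in_arcs G y) (in_arcs G z)"
      "\<forall>e \<in> in_arcs G y. (tail G e, tail G (\<psi> e)) \<in> r"
      unfolding locally_congruent_def by blast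
    have "(tail G e, tail G ((\<psi> \<circ> \<phi>) e)) \<in> r\<^sup>+" if "e \<in> in_arcs G x" for e
      using trancl_into_trancl that \<phi>(2) \<psi>(2) bij_betwE[OF \<phi>(1)] by (metis comp_apply)
    then show ?case using bij_betw_trans[OF \<phi>(1) \<psi>(1)] by blast
  qed
  then show ?thesis unfolding locally_congruent_def by blast
qed

text \<open>The quotient of \<open>B\<close> by \<open>r\<close> is realised on representatives,
  hence in the types of \<open>B\<close>, where \<open>basal\<close> applies: the projection is an
  isomorphism, so no two distinct nodes share a representative.\<close>

lemma basal_locally_congruent_eq:
  fixes B :: "('a, 'b) pre_digraph"
  assumes "basal B" and r: "equiv (verts B) r" "locally_congruent B r" and xy: "(x, y) \<in> r"
  shows "x = y"
proof -
  have wf: "wf_digraph B" using \<open>basal B\<close> by (simp add: basal_def)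
  define rep where "rep u = (SOME v. (u, v) \<in> r)" for u
  have sub: "r \<subseteq> verts B \<times> verts B" using r(1) by (simp add: equiv_def refl_on_def)
  have rep: "(u, rep u) \<in> r" if "u \<in> verts B" for u
    unfolding rep_def by (rule someI[of _ u]) (use that r(1) in \<open>auto simp: equiv_def refl_on_def\<close>)
  have repV: "rep u \<in> verts B" if "u \<in> verts B" for u using rep[OF that] sub by blast
  have rep_eq: "rep u = rep v" if "(u, v) \<in> r" for u v
  proof -
    have "(u, w) \<in> r \<longleftrightarrow> (v, w) \<in> r" for w
      using that r(1) by (meson equivE symD transD)
    then show ?thesis by (simp add: rep_def)
  qed
  have rep_idem: "rep (rep u) = rep u" if "u \<in> verts B" for u
    using rep_eq[OF rep[OF that]] by simp
  have "\<forall>u \<in> verts B. \<exists>\<phi>. bij_betw \<phi> (in_arcs B u) (in_arcs B (rep u)) \<and>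
      (\<forall>e \<in> in_arcs B u. (tail B e, tail B (\<phi> e)) \<in> r)"
    using r(2) rep unfolding locally_congruent_def by blast
  then obtain \<phi> where \<phi>: "\<And>u. u \<in> verts B \<Longrightarrow> bij_betw (\<phi> u) (in_arcs B u) (in_arcs B (rep u))"
    "\<And>u e. u \<in> verts B \<Longrightarrow> e \<in> in_arcs B u \<Longrightarrow> (tail B e, tail B (\<phi> u e)) \<in> r"
    by metis
  \<comment> \<open>Each class inherits the incoming arcs of its representative, with tails moved to
    representatives. The projection \<open>f\<close> carries an arc there by the bijection chosen
    for its head.\<close>
  define Q where "Q = \<lparr>verts = rep ` verts B, arcs = {e \<in> arcs B. head B e \<in> rep ` verts B},
    tail = (\<lambda>e. rep (tail B e)), head = head B\<rparr>"
  define f where "f = (rep, \<lambda>e. \<phi> (head B e) e)"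
  have wfB: "tail B e \<in> verts B" "head B e \<in> verts B" if "e \<in> arcs B" for e
    using wf that by (auto simp: wf_digraph_def)
  have wfQ: "wf_digraph Q"
    by unfold_locales (auto simp: Q_def wfB)
  have \<phi>_in: "\<phi> (head B e) e \<in> in_arcs B (rep (head B e))" if "e \<in> arcs B" for e
    using bij_betwE[OF \<phi>(1)[OF wfB(2)[OF that]]] that by simp
  have \<phi>_tail: "rep (tail B (\<phi> (head B e) e)) = rep (tail B e)" if "e \<in> arcs B" for e
    using rep_eq[OF \<phi>(2)[OF wfB(2)[OF that]]] that by simp
  have mor: "graph_morphism B Q f"
    using wf wfQ wfB \<phi>_in \<phi>_tail by (auto simp: graph_morphism_def f_def Q_def)
  have "bij_betw (snd f) (in_arcs B u) (in_arcs Q (fst f u))" if u: "u \<in> verts B" for u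
  proof -
    have "in_arcs Q (fst f u) = in_arcs B (rep u)"
      using u by (auto simp: f_def Q_def)
    moreover have "bij_betw (snd f) (in_arcs B u) (in_arcs B (rep u)) \<longleftrightarrow>
        bij_betw (\<phi> u) (in_arcs B u) (in_arcs B (rep u))"
      by (rule bij_betw_cong) (simp add: f_def)
    ultimately show ?thesis using \<phi>(1)[OF u] by simp
  qed
  with mor have "epic_covering B Q f"
    by (simp add: epic_covering_def covering_def f_def Q_def)
  then have "graph_isomorphism B Q f"
    using \<open>basal B\<close> unfolding basal_def by blast
  then have "inj_on rep (verts B)"
    by (auto simp: graph_isomorphism_def bij_betw_def f_def)
  then show ?thesis using rep_eq[OF xy] xy sub by (auto dest: inj_onD)
qed

lemma covering_bij_in_arcs:
  assumes "covering X Y f" "x \<in> verts X"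
  shows "bij_betw (snd f) (in_arcs X x) (in_arcs Y (fst f x))"
  using assms by (simp add: covering_def)

lemma covering_tail:
  assumes "covering X Y f" "e \<in> arcs X"
  shows "tail X e \<in> verts X" "tail Y (snd f e) = fst f (tail X e)"
  using assms by (auto simp: covering_def graph_morphism_def wf_digraph_def)

text \<open>Both sets of incoming arcs are copies of \<open>in_arcs X x\<close>. The second property
  ties the bijection to \<open>X\<close>, which later allows tails to be compared.\<close>

lemma covering_in_arcs_transport:
  assumes f: "covering X Y f" and g: "covering X Z g" and x: "x \<in> verts X"
  obtains \<phi> where "bij_betw \<phi> (in_arcs Y (fst f x)) (in_arcs Z (fst g x))"
    and "\<And>e. e \<in> in_arcs X x \<Longrightarrow> \<phi> (snd f e) = snd g e"
proof
  let ?i = "inv_into (in_arcs X x) (snd f)"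
  note bf = covering_bij_in_arcs[OF f x]
  show "bij_betw (snd g \<circ> ?i) (in_arcs Y (fst f x)) (in_arcs Z (fst g x))"
    by (rule bij_betw_trans[OF bij_betw_inv_into[OF bf] covering_bij_in_arcs[OF g x]])
  show "(snd g \<circ> ?i) (snd f e) = snd g e" if "e \<in> in_arcs X x" for e
    using bij_betw_inv_into_left[OF bf that] by simp
qed

lemma covering_in_arcsE:
  assumes "covering X Y f" "x \<in> verts X" "a \<in> in_arcs Y (fst f x)"
  obtains e where "e \<in> in_arcs X x" "a = snd f e"
  using covering_bij_in_arcs[OF assms(1,2)] assms(3) unfolding bij_betw_def by blast

lemma basing_factors_on_nodes:
  fixes X :: "('a, 'b) pre_digraph" and B :: "('c, 'd) pre_digraph"
    and C :: "('e, 'f) pre_digraph"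
  assumes p: "basing X B p" and q: "covering X C q"
    and xy: "x \<in> verts X" "y \<in> verts X" "fst q x = fst q y"
  shows "fst p x = fst p y"
proof -
  have cp: "covering X B p" and surj: "fst p ` verts X = verts B" and "basal B"
    using p by (auto simp: basing_def epic_covering_def)
  \<comment> \<open>Transitivity may fail: \<open>fst p v = fst p v'\<close> does not make
    \<open>v\<close> and \<open>v'\<close> agree under \<open>q\<close>. Hence the closure
    below.\<close>
  define r where
    "r = {(fst p u, fst p v) | u v. u \<in> verts X \<and> v \<in> verts X \<and> fst q u = fst q v}"
  have "\<exists>\<phi>. bij_betw \<phi> (in_arcs B a) (in_arcs B b) \<and>
      (\<forall>e \<in> in_arcs B a. (tail B e, tail B (\<phi> e)) \<in> r)" if "(a, b) \<in> r" for a b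
  proof -
    from that obtain u v where uv: "u \<in> verts X" "v \<in> verts X" "fst q u = fst q v"
      and ab: "a = fst p u" "b = fst p v" by (auto simp: r_def)
    obtain \<phi> where \<phi>: "bij_betw \<phi> (in_arcs B a) (in_arcs C (fst q u))"
      "\<And>e. e \<in> in_arcs X u \<Longrightarrow> \<phi> (snd p e) = snd q e"
      using covering_in_arcs_transport[OF cp q uv(1)] ab by metis
    obtain \<psi> where \<psi>: "bij_betw \<psi> (in_arcs C (fst q u)) (in_arcs B b)"
      "\<And>e. e \<in> in_arcs X v \<Longrightarrow> \<psi> (snd q e) = snd p e"
      using covering_in_arcs_transport[OF q cp uv(2)] ab uv(3) by metis
    have "(tail B e, tail B ((\<psi> \<circ> \<phi>) e)) \<in> r" if e: "e \<in> in_arcs B a" for e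
    proof -
      obtain d where d: "d \<in> in_arcs X u" "e = snd p d"
        using covering_in_arcsE[OF cp uv(1)] e ab by metis
      \<comment> \<open>The arc is pushed to \<open>C\<close> over \<open>u\<close> and lifted back
        over \<open>v\<close>. As \<open>d\<close> and \<open>d'\<close> have the same image under
        \<open>q\<close>, so do their tails, which are thus witnesses for \<open>r\<close>.\<close>
      have "snd q d \<in> in_arcs C (fst q v)"
        using bij_betwE[OF covering_bij_in_arcs[OF q uv(1)]] d(1) uv(3) by simp
      then obtain d' where d': "d' \<in> in_arcs X v" "snd q d = snd q d'"
        using covering_in_arcsE[OF q uv(2)] by metis
      have dX: "d \<in> arcs X" "d' \<in> arcs X" using d d' by auto
      have "(\<psi> \<circ> \<phi>) e = snd p d'"
        using \<phi>(2) \<psi>(2) d d' by simp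
      moreover have "fst q (tail X d) = fst q (tail X d')"
        using covering_tail(2)[OF q] dX d'(2) by metis
      ultimately show ?thesis
        unfolding r_def using covering_tail[OF cp] dX d(2) by auto
    qed
    then show ?thesis using bij_betw_trans[OF \<phi>(1) \<psi>(1)] by blast
  qed
  then have "locally_congruent B r" unfolding locally_congruent_def by blast
  then have loc: "locally_congruent B (r\<^sup>+)" by (rule locally_congruent_trancl)
  have "r \<subseteq> verts B \<times> verts B" using surj by (auto simp: r_def)
  then have "r\<^sup>+ \<subseteq> verts B \<times> verts B" by (rule trancl_subset_Sigma)
  moreover have "(a, a) \<in> r" if "a \<in> verts B" for a
    using that unfolding r_def surj[symmetric] by blast
  moreover have "sym r" by (auto simp: sym_def r_def) metis
  ultimately have "equiv (verts B) (r\<^sup>+)"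
    by (auto simp: equiv_def refl_on_def sym_trancl)
  moreover have "(fst p x, fst p y) \<in> r\<^sup>+" using xy by (auto simp: r_def)
  ultimately show ?thesis
    using basal_locally_congruent_eq[OF \<open>basal B\<close> _ loc] by blast
qed

lemma basing_unique:
  fixes X :: "('a, 'b) pre_digraph" and B :: "('c, 'd) pre_digraph"
    and B' :: "('e, 'f) pre_digraph"
  assumes p: "basing X B p" and p': "basing X B' p'"
  obtains h where "graph_isomorphism B' B h" "\<And>x. x \<in> verts X \<Longrightarrow> fst h (fst p' x) = fst p x"
proof -
  have cp: "covering X B p" and surj: "fst p ` verts X = verts B"
    and cp': "covering X B' p'" and surj': "fst p' ` verts X = verts B'" and "basal B'"
    using p p' by (auto simp: basing_def epic_covering_def)
  have wf: "wf_digraph B" "wf_digraph B'"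
    using cp cp' by (auto simp: covering_def graph_morphism_def)
  \<comment> \<open>An arbitrary section of \<open>p'\<close> on nodes; by \<open>node\<close>,
    \<open>fst p \<circ> s\<close> does not depend on the choice.\<close>
  define s where "s = inv_into (verts X) (fst p')"
  have s: "s b \<in> verts X" "fst p' (s b) = b" if "b \<in> verts B'" for b
    using that surj' by (auto simp: s_def f_inv_into_f inv_into_into)
  have node: "fst p (s (fst p' x)) = fst p x" if "x \<in> verts X" for x
  proof -
    have "fst p' x \<in> verts B'" using that surj' by auto
    then show ?thesis using basing_factors_on_nodes[OF p cp'] s that by blast
  qed
  have "\<forall>b \<in> verts B'. \<exists>\<phi>. bij_betw \<phi> (in_arcs B' b) (in_arcs B (fst p (s b))) \<and>
      (\<forall>e \<in> in_arcs X (s b). \<phi> (snd p' e) = snd p e)"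
    using covering_in_arcs_transport[OF cp' cp] s by metis
  then obtain \<phi> where \<phi>:
    "\<And>b. b \<in> verts B' \<Longrightarrow> bij_betw (\<phi> b) (in_arcs B' b) (in_arcs B (fst p (s b)))"
    "\<And>b e. b \<in> verts B' \<Longrightarrow> e \<in> in_arcs X (s b) \<Longrightarrow> \<phi> b (snd p' e) = snd p e"
    by metis
  \<comment> \<open>The arc map is chosen separately at each head. Agreement of
    \<open>h \<circ> p'\<close> with \<open>p\<close> on arcs is ensured only for arcs entering a
    chosen node \<open>s b\<close>.\<close>
  define h where "h = (fst p \<circ> s, \<lambda>e. \<phi> (head B' e) e)"
  have hd: "head B' e \<in> verts B'" if "e \<in> arcs B'" for e
    using wf(2) that by (simp add: wf_digraph_def)
  have h_in: "snd h e \<in> in_arcs B (fst h (head B' e))" if "e \<in> arcs B'" for e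
    using bij_betwE[OF \<phi>(1)[OF hd[OF that]]] that by (simp add: h_def)
  have h_tail: "tail B (snd h e) = fst h (tail B' e)" if e: "e \<in> arcs B'" for e
  proof -
    note b = hd[OF e]
    \<comment> \<open>Lifting \<open>e\<close> to an arc \<open>d\<close> entering the chosen node
      makes \<open>snd h e\<close> equal to \<open>snd p d\<close>; \<open>node\<close> at the tail
      of \<open>d\<close> then gives the claim.\<close>
    have "e \<in> in_arcs B' (fst p' (s (head B' e)))" using e s(2)[OF b] by simp
    then obtain d where d: "d \<in> in_arcs X (s (head B' e))" "e = snd p' d"
      using covering_in_arcsE[OF cp' s(1)[OF b]] by metis
    have dX: "d \<in> arcs X" using d by simp
    have "snd h e = snd p d" using \<phi>(2)[OF b d(1)] d(2) by (simp add: h_def)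
    then show ?thesis
      using covering_tail[OF cp dX] covering_tail[OF cp' dX] d(2) node by (simp add: h_def)
  qed
  have hV: "fst h ` verts B' = verts B"
    by (simp add: h_def image_image node flip: surj surj')
  have mor: "graph_morphism B' B h"
    using wf hV h_in h_tail by (auto simp: graph_morphism_def)
  have "bij_betw (snd h) (in_arcs B' b) (in_arcs B (fst h b))" if b: "b \<in> verts B'" for b
  proof -
    have "bij_betw (snd h) (in_arcs B' b) (in_arcs B (fst h b)) \<longleftrightarrow>
        bij_betw (\<phi> b) (in_arcs B' b) (in_arcs B (fst h b))"
      by (rule bij_betw_cong) (simp add: h_def)
    then show ?thesis using \<phi>(1)[OF b] by (simp add: h_def)
  qed
  with mor hV have "epic_covering B' B h" by (simp add: epic_covering_def covering_def)
  \<comment> \<open>\<open>B\<close> and \<open>B'\<close> may have different types, so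
    \<open>basal\<close> must be used in its type-independent form.\<close>
  then have "graph_isomorphism B' B h" by (rule basal_any_type[OF \<open>basal B'\<close>])
  then show thesis using that node by (simp add: h_def)
qed

theorem mainTheorem5:
  fixes X :: "('a, 'b) pre_digraph"
    and B :: "('c, 'd) pre_digraph"
    and B' :: "('e, 'f) pre_digraph"
    and p :: "('a, 'b, 'c, 'd) graph_map"
    and p' :: "('a, 'b, 'e, 'f) graph_map"
  assumes "wf_digraph X"
    and "basing X B p"
    and "basing X B' p'"
  shows "isomorphic_graphs B B' \<and>
    (\<exists>h. graph_isomorphism B' B h \<and> (\<forall>x \<in> verts X. (fst h \<circ> fst p') x = fst p x))"
proof
  show "isomorphic_graphs B B'"
    \<comment> \<open>Exchanging the two basings gives the direction from \<open>B\<close> to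
      \<open>B'\<close> without inverting \<open>h\<close>.\<close>
    using basing_unique[OF assms(3,2)] unfolding isomorphic_graphs_def by metis
  show "\<exists>h. graph_isomorphism B' B h \<and> (\<forall>x \<in> verts X. (fst h \<circ> fst p') x = fst p x)"
    using basing_unique[OF assms(2,3)] by (metis comp_apply)
qed

end
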